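(* Let $\mathcal{R}$ be an integral domain and $\Lambda$ a nonempty set. Let $S$ be the multiplicative semigroup generated by all $x_\lambda,y_\lambda$ ($\lambda\in\Lambda$). Then the localization $S^{-1}\big(\mathcal{R}[\Lambda]/I_1\big)$ is isomorphic to the localization $S^{-1}\big(\mathcal{R}[x_\lambda,y_\lambda:\lambda\in\Lambda][X,Y]\big)$ of the polynomial ring in the variables $x_\lambda,y_\lambda$ ($\lambda\in\Lambda$) and two further variables $X,Y$, by an isomorphism under which each $x_\lambda$ and $y_\lambda$ corresponds to itself, each $X_\lambda$ corresponds to $x_\lambda+Xy_\lambda$ and each $Y_\lambda$ corresponds to $y_\lambda+Yx_\lambda$.
   Context: $\mathcal{R}[\Lambda]=\mathcal{R}[X_\lambda,Y_\lambda,x_\lambda,y_\lambda:\lambda\in\Lambda]$ is the polynomial ring in four variables per color, and $I_1$ is the ideal generated by all polynomials $\det\begin{pmatrix}X_\lambda & y_\lambda\\ X_\mu & y_\mu\end{pmatrix}-\det\begin{pmatrix}x_\lambda & y_\lambda\\ x_\mu & y_\mu\end{pmatrix}$ and $\det\begin{pmatrix}x_\lambda & y_\lambda\\ x_\mu & y_\mu\end{pmatrix}-\det\begin{pmatrix}x_\lambda & Y_\lambda\\ x_\mu & Y_\mu\end{pmatrix}$ for $\lambda,\mu\in\Lambda$ (it is a prime ideal, so the quotient is a domain). *)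

theory Defs
  imports
    "HOL-Library.Poly_Mapping"
    "HOL-Algebra.QuotRing"
    "HOL-Algebra.Algebraic_Closure_Type"
begin

section \<open>Polynomial rings\<close>

text \<open>
  Monomials are finitely supported exponent functions, and polynomials are finitely
  supported functions from monomials to coefficients; the variables are indexed by all
  elements of an arbitrary, possibly infinite, type.
\<close>

type_synonym ('v, 'r) mvpoly = "('v \<Rightarrow>\<^sub>0 nat) \<Rightarrow>\<^sub>0 'r"

definition mvconst :: "'r \<Rightarrow> ('v, 'r::comm_ring_1) mvpoly"
  where "mvconst c = Poly_Mapping.single 0 c"

definition mvvar :: "'v \<Rightarrow> ('v, 'r::comm_ring_1) mvpoly"
  where "mvvar v = Poly_Mapping.single (Poly_Mapping.single v 1) 1"


section \<open>Localization of a commutative ring\<close>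

inductive_set gen_semigroup :: "('a, 'm) monoid_scheme \<Rightarrow> 'a set \<Rightarrow> 'a set"
  for A and G where
    incl: "g \<in> G \<Longrightarrow> g \<in> gen_semigroup A G"
  | mult: "s \<in> gen_semigroup A G \<Longrightarrow> t \<in> gen_semigroup A G \<Longrightarrow> s \<otimes>\<^bsub>A\<^esub> t \<in> gen_semigroup A G"

text \<open>
  A multiplicative semigroup need not contain the identity, which is therefore adjoined to
  the set of denominators. This changes nothing if \<open>\<one> \<in> S\<close>, and does not affect the
  localization otherwise. The following definitions are meant for a commutative ring
  \<open>A\<close> and a set \<open>S \<subseteq> carrier A\<close> closed under multiplication; zero divisors in \<open>S\<close>
  are allowed, whence the additional factor \<open>u\<close>.
\<close>

definition denoms :: "('a, 'm) ring_scheme \<Rightarrow> 'a set \<Rightarrow> 'a set"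
  where "denoms A S = insert \<one>\<^bsub>A\<^esub> S"

definition frac_rel :: "('a, 'm) ring_scheme \<Rightarrow> 'a set \<Rightarrow> (('a \<times> 'a) \<times> ('a \<times> 'a)) set"
  where "frac_rel A S = {((a, s), (b, t)).
    a \<in> carrier A \<and> b \<in> carrier A \<and> s \<in> denoms A S \<and> t \<in> denoms A S \<and>
    (\<exists>u \<in> denoms A S. u \<otimes>\<^bsub>A\<^esub> ((a \<otimes>\<^bsub>A\<^esub> t) \<ominus>\<^bsub>A\<^esub> (b \<otimes>\<^bsub>A\<^esub> s)) = \<zero>\<^bsub>A\<^esub>)}"

definition frac :: "('a, 'm) ring_scheme \<Rightarrow> 'a set \<Rightarrow> 'a \<Rightarrow> 'a \<Rightarrow> ('a \<times> 'a) set"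
  where "frac A S a s = frac_rel A S `` {(a, s)}"

text \<open>
  Sum and product are given on representatives; all representatives yield the same class, so the
  unions below are unions of equal sets.
\<close>

definition localization :: "('a, 'm) ring_scheme \<Rightarrow> 'a set \<Rightarrow> ('a \<times> 'a) set ring"
  where "localization A S =
    \<lparr> carrier = (carrier A \<times> denoms A S) // frac_rel A S,
      monoid.mult = (\<lambda>P Q. \<Union>(a, s) \<in> P. \<Union>(b, t) \<in> Q. frac A S (a \<otimes>\<^bsub>A\<^esub> b) (s \<otimes>\<^bsub>A\<^esub> t)),
      one = frac A S \<one>\<^bsub>A\<^esub> \<one>\<^bsub>A\<^esub>,
      ring.zero = frac A S \<zero>\<^bsub>A\<^esub> \<one>\<^bsub>A\<^esub>,
      add = (\<lambda>P Q. \<Union>(a, s) \<in> P. \<Union>(b, t) \<in> Q.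
               frac A S ((a \<otimes>\<^bsub>A\<^esub> t) \<oplus>\<^bsub>A\<^esub> (b \<otimes>\<^bsub>A\<^esub> s)) (s \<otimes>\<^bsub>A\<^esub> t)) \<rparr>"

definition loc_map :: "('a, 'm) ring_scheme \<Rightarrow> 'a set \<Rightarrow> 'a \<Rightarrow> ('a \<times> 'a) set"
  where "loc_map A S a = frac A S a \<one>\<^bsub>A\<^esub>"


section \<open>The ring in four variables per color, modulo \<open>I\<^sub>1\<close>\<close>

text \<open>The set of colors is an arbitrary type \<open>'l\<close>; types are nonempty.\<close>

datatype 'l color_var = CX 'l | CY 'l | Cx 'l | Cy 'l

type_synonym ('l, 'r) color_poly = "('l color_var, 'r) mvpoly"

definition color_ring :: "('l, 'r::comm_ring_1) color_poly ring"
  where "color_ring = ring_of_type_algebra"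

text \<open>The determinant of the matrix with rows \<open>(a, b)\<close> and \<open>(c, d)\<close>.\<close>

definition det2 :: "'a \<Rightarrow> 'a \<Rightarrow> 'a \<Rightarrow> 'a \<Rightarrow> 'a::comm_ring_1"
  where "det2 a b c d = a * d - b * c"

definition I1_gens :: "('l, 'r::comm_ring_1) color_poly set"
  where "I1_gens =
    {det2 (mvvar (CX l)) (mvvar (Cy l))
          (mvvar (CX m)) (mvvar (Cy m))
     - det2 (mvvar (Cx l)) (mvvar (Cy l))
            (mvvar (Cx m)) (mvvar (Cy m)) | l m. True}
    \<union>
    {det2 (mvvar (Cx l)) (mvvar (Cy l))
          (mvvar (Cx m)) (mvvar (Cy m))
     - det2 (mvvar (Cx l)) (mvvar (CY l))
            (mvvar (Cx m)) (mvvar (CY m)) | l m. True}"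

definition I1 :: "('l, 'r::comm_ring_1) color_poly set"
  where "I1 = Idl\<^bsub>color_ring\<^esub> I1_gens"

definition color_quot :: "('l, 'r::comm_ring_1) color_poly set ring"
  where "color_quot = color_ring Quot I1"

definition color_class :: "('l, 'r::comm_ring_1) color_poly \<Rightarrow> ('l, 'r) color_poly set"
  where "color_class p = I1 +>\<^bsub>color_ring\<^esub> p"

definition S_quot :: "('l, 'r::comm_ring_1) color_poly set set"
  where "S_quot = gen_semigroup color_quot
    (range (\<lambda>l. color_class (mvvar (Cx l))) \<union> range (\<lambda>l. color_class (mvvar (Cy l))))"

definition color_loc :: "(('l, 'r::comm_ring_1) color_poly set \<times> ('l, 'r) color_poly set) set ring"
  where "color_loc = localization color_quot S_quot"

definition to_color_loc ::
    "('l, 'r::comm_ring_1) color_poly \<Rightarrow> (('l, 'r) color_poly set \<times> ('l, 'r) color_poly set) set"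
  where "to_color_loc p = loc_map color_quot S_quot (color_class p)"


section \<open>The polynomial ring in \<open>x\<^sub>\<lambda>\<close>, \<open>y\<^sub>\<lambda>\<close> and two further variables\<close>

datatype 'l small_var = Sx 'l | Sy 'l

datatype big_var = BX | BY

text \<open>
  The ring is built in two steps, as \<open>R[x\<^sub>\<lambda>, y\<^sub>\<lambda>][X, Y]\<close>: the coefficients of a polynomial
  in \<open>X\<close> and \<open>Y\<close> are polynomials in the \<open>x\<^sub>\<lambda>\<close> and \<open>y\<^sub>\<lambda>\<close>.
\<close>

type_synonym ('l, 'r) target_poly = "(big_var, ('l small_var, 'r) mvpoly) mvpoly"

definition target_ring :: "('l, 'r::comm_ring_1) target_poly ring"
  where "target_ring = ring_of_type_algebra"

definition tconst :: "'r::comm_ring_1 \<Rightarrow> ('l, 'r) target_poly"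
  where "tconst c = mvconst (mvconst c)"

definition tx :: "'l \<Rightarrow> ('l, 'r::comm_ring_1) target_poly"
  where "tx l = mvconst (mvvar (Sx l))"

definition ty :: "'l \<Rightarrow> ('l, 'r::comm_ring_1) target_poly"
  where "ty l = mvconst (mvvar (Sy l))"

definition tX :: "('l, 'r::comm_ring_1) target_poly"
  where "tX = mvvar BX"

definition tY :: "('l, 'r::comm_ring_1) target_poly"
  where "tY = mvvar BY"

definition S_target :: "('l, 'r::comm_ring_1) target_poly set"
  where "S_target = gen_semigroup target_ring (range tx \<union> range ty)"

definition target_loc :: "(('l, 'r::comm_ring_1) target_poly \<times> ('l, 'r) target_poly) set ring"
  where "target_loc = localization target_ring S_target"

definition to_target_loc ::
    "('l, 'r::comm_ring_1) target_poly \<Rightarrow> (('l, 'r) target_poly \<times> ('l, 'r) target_poly) set"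
  where "to_target_loc p = loc_map target_ring S_target p"

end

theory Submission
  imports Defs "HOL-Computational_Algebra.Polynomial"
begin

text \<open>
  Sending \<open>X\<^sub>\<lambda>\<close> to \<open>x\<^sub>\<lambda> + X y\<^sub>\<lambda>\<close> and \<open>Y\<^sub>\<lambda>\<close> to \<open>y\<^sub>\<lambda> + Y x\<^sub>\<lambda>\<close> kills \<open>I\<^sub>1\<close> and maps the
  denominators onto the denominators. It is onto up to denominators because
  \<open>X\<^sub>\<lambda> - x\<^sub>\<lambda> \<mapsto> y\<^sub>\<lambda> X\<close> and \<open>Y\<^sub>\<lambda> - y\<^sub>\<lambda> \<mapsto> x\<^sub>\<lambda> Y\<close>. For injectivity, fix a color \<open>m\<close>, let
  \<open>w = x\<^sub>m y\<^sub>m\<close> and adjoin a variable \<open>t\<close> to the ring in four variables per color. Mapping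
  \<open>X\<close> to \<open>(X\<^sub>m - x\<^sub>m) x\<^sub>m t\<close> and \<open>Y\<close> to \<open>(Y\<^sub>m - y\<^sub>m) y\<^sub>m t\<close> inverts the first map modulo
  \<open>I\<^sub>1[t] + (w t - 1)\<close>, by the defining relations of \<open>I\<^sub>1\<close>. Hence a polynomial \<open>p\<close> with image \<open>0\<close>
  lies in \<open>I\<^sub>1[t] + (w t - 1)\<close>, and comparing coefficients of powers of \<open>t\<close> shows that some
  \<open>w\<^sup>N p\<close> lies in \<open>I\<^sub>1\<close>.
\<close>

section \<open>Isomorphisms of localizations\<close>

text \<open>A semigroup may lack the identity, so only closure under products is assumed of
  \<open>S\<close>; \<open>denoms A S\<close> is then a submonoid, which is what the arithmetic of
  fractions uses.\<close>

locale localization_setting = cring A for A (structure) +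
  fixes S
  assumes S_carrier: "S \<subseteq> carrier A"
    and S_mult: "s \<in> S \<Longrightarrow> t \<in> S \<Longrightarrow> s \<otimes> t \<in> S"
begin

abbreviation D where "D \<equiv> denoms A S"

lemma denoms_closed [simp, intro]: "s \<in> D \<Longrightarrow> s \<in> carrier A"
  using S_carrier by (auto simp: denoms_def)

lemma one_in_denoms [simp, intro]: "\<one> \<in> D"
  by (simp add: denoms_def)

lemma denoms_mult [simp, intro]: "s \<in> D \<Longrightarrow> t \<in> D \<Longrightarrow> s \<otimes> t \<in> D"
  using S_mult S_carrier by (auto simp: denoms_def)

lemma frac_rel_iff:
  "((a, s), (b, t)) \<in> frac_rel A S \<longleftrightarrow>
     a \<in> carrier A \<and> b \<in> carrier A \<and> s \<in> D \<and> t \<in> D \<and> (\<exists>u\<in>D. u \<otimes> (a \<otimes> t \<ominus> b \<otimes> s) = \<zero>)"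
  by (simp add: frac_rel_def)

lemma frac_relI:
  assumes "a \<in> carrier A" "b \<in> carrier A" "s \<in> D" "t \<in> D" "u \<in> D"
    and "u \<otimes> (a \<otimes> t \<ominus> b \<otimes> s) = \<zero>"
  shows "((a, s), (b, t)) \<in> frac_rel A S"
  using assms by (auto simp: frac_rel_iff)

lemma frac_relE:
  assumes "((a, s), (b, t)) \<in> frac_rel A S"
  obtains u where "a \<in> carrier A" "b \<in> carrier A" "s \<in> D" "t \<in> D" "u \<in> D"
    "u \<otimes> (a \<otimes> t \<ominus> b \<otimes> s) = \<zero>"
  using assms by (auto simp: frac_rel_iff)

lemma equiv_frac_rel: "equiv (carrier A \<times> D) (frac_rel A S)"
proof (rule equivI)
  show "frac_rel A S \<subseteq> (carrier A \<times> D) \<times> (carrier A \<times> D)"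
    by (auto simp: frac_rel_def)
  show "refl_on (carrier A \<times> D) (frac_rel A S)"
    by (auto intro!: refl_onI frac_relI[where u = \<one>] simp: minus_eq r_neg)
  show "sym (frac_rel A S)"
  proof (rule symI, clarify)
    fix a s b t assume "((a, s), (b, t)) \<in> frac_rel A S"
    then obtain u where ab [simp]: "a \<in> carrier A" "b \<in> carrier A" "s \<in> D" "t \<in> D" "u \<in> D"
      and u: "u \<otimes> (a \<otimes> t \<ominus> b \<otimes> s) = \<zero>" by (rule frac_relE)
    have carr [simp]: "s \<in> carrier A" "t \<in> carrier A" "u \<in> carrier A" by auto
    have "u \<otimes> (b \<otimes> s \<ominus> a \<otimes> t) = \<ominus> (u \<otimes> (a \<otimes> t \<ominus> b \<otimes> s))" using ab carr by algebra
    with u show "((b, t), (a, s)) \<in> frac_rel A S" by (intro frac_relI[where u = u]) auto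
  qed
  show "trans (frac_rel A S)"
  proof (rule transI, clarify)
    fix a s b t c x
    assume "((a, s), (b, t)) \<in> frac_rel A S" and "((b, t), (c, x)) \<in> frac_rel A S"
    then obtain u v where ab [simp]: "a \<in> carrier A" "b \<in> carrier A" "c \<in> carrier A"
        "s \<in> D" "t \<in> D" "x \<in> D" "u \<in> D" "v \<in> D"
      and u: "u \<otimes> (a \<otimes> t \<ominus> b \<otimes> s) = \<zero>" and v: "v \<otimes> (b \<otimes> x \<ominus> c \<otimes> t) = \<zero>"
      by (metis frac_relE)
    have carr [simp]: "s \<in> carrier A" "t \<in> carrier A" "x \<in> carrier A" "u \<in> carrier A" "v \<in> carrier A"
      by auto
    \<comment> \<open>Zero divisors may be denominators, so the middle denominator \<open>t\<close>
      cannot be cancelled and joins the witness: t (a x - c s) = x (a t - b s) + s (b x - c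
      t).\<close>
    have "u \<otimes> v \<otimes> t \<otimes> (a \<otimes> x \<ominus> c \<otimes> s) =
        v \<otimes> x \<otimes> (u \<otimes> (a \<otimes> t \<ominus> b \<otimes> s)) \<oplus> u \<otimes> s \<otimes> (v \<otimes> (b \<otimes> x \<ominus> c \<otimes> t))"
      using ab carr by algebra
    with u v show "((a, s), (c, x)) \<in> frac_rel A S"
      by (intro frac_relI[where u = "u \<otimes> v \<otimes> t"]) auto
  qed
qed

lemma frac_eq_iff:
  assumes "a \<in> carrier A" "b \<in> carrier A" "s \<in> D" "t \<in> D"
  shows "frac A S a s = frac A S b t \<longleftrightarrow> (\<exists>u\<in>D. u \<otimes> (a \<otimes> t \<ominus> b \<otimes> s) = \<zero>)"
  using eq_equiv_class_iff[OF equiv_frac_rel, of "(a, s)" "(b, t)"] assms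
  by (simp add: frac_def frac_rel_iff)

lemma frac_eqI:
  assumes "a \<in> carrier A" "b \<in> carrier A" "s \<in> D" "t \<in> D" "u \<in> D"
    and "u \<otimes> (a \<otimes> t \<ominus> b \<otimes> s) = \<zero>"
  shows "frac A S a s = frac A S b t"
  using assms frac_eq_iff by blast

lemma carrier_localization:
  "carrier (localization A S) = {frac A S a s | a s. a \<in> carrier A \<and> s \<in> D}"
  by (auto simp: localization_def quotient_def frac_def)

lemma frac_closed [simp, intro]:
  "a \<in> carrier A \<Longrightarrow> s \<in> D \<Longrightarrow> frac A S a s \<in> carrier (localization A S)"
  by (auto simp: carrier_localization)

text \<open>The product is a union over all pairs of representatives. Once the class is independent
  of them, the union collapses to one class; commutativity reduces the check to varying the second
  factor.\<close>

lemma frac_mult: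
  assumes "a \<in> carrier A" "b \<in> carrier A" "s \<in> D" "t \<in> D"
  shows "frac A S a s \<otimes>\<^bsub>localization A S\<^esub> frac A S b t = frac A S (a \<otimes> b) (s \<otimes> t)"
proof -
  have "(\<lambda>(a, s) (b, t). frac A S (a \<otimes> b) (s \<otimes> t)) respects2 (frac_rel A S)"
  proof (rule congruent2_commuteI[OF equiv_frac_rel], clarify)
    fix a s b t assume "a \<in> carrier A" "s \<in> D" "b \<in> carrier A" "t \<in> D"
    then show "frac A S (a \<otimes> b) (s \<otimes> t) = frac A S (b \<otimes> a) (t \<otimes> s)"
      by (metis m_comm denoms_closed)
  next
    fix y z w assume w: "w \<in> carrier A \<times> D" and yz: "(y, z) \<in> frac_rel A S"
    obtain c x a s b t where [simp]: "w = (c, x)" "y = (a, s)" "z = (b, t)"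
      by (metis surj_pair)
    obtain u where ab [simp]: "a \<in> carrier A" "b \<in> carrier A" "s \<in> D" "t \<in> D" "u \<in> D"
      and u: "u \<otimes> (a \<otimes> t \<ominus> b \<otimes> s) = \<zero>" using yz by (auto elim: frac_relE)
    have carr [simp]: "s \<in> carrier A" "t \<in> carrier A" "u \<in> carrier A" "c \<in> carrier A" "x \<in> D"
      "x \<in> carrier A" using w by auto
    have "u \<otimes> (c \<otimes> a \<otimes> (x \<otimes> t) \<ominus> c \<otimes> b \<otimes> (x \<otimes> s)) = c \<otimes> x \<otimes> (u \<otimes> (a \<otimes> t \<ominus> b \<otimes> s))"
      using ab carr by algebra
    with u show "(case w of (a, s) \<Rightarrow> \<lambda>(b, t). frac A S (a \<otimes> b) (s \<otimes> t)) y =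
        (case w of (a, s) \<Rightarrow> \<lambda>(b, t). frac A S (a \<otimes> b) (s \<otimes> t)) z"
      by (simp, intro frac_eqI[where u = u]) auto
  qed
  from UN_equiv_class2[OF equiv_frac_rel equiv_frac_rel this, of "(a, s)" "(b, t)"] assms
  show ?thesis by (simp add: localization_def frac_def[of A S a s] frac_def[of A S b t]
      case_prod_unfold)
qed

lemma frac_add:
  assumes "a \<in> carrier A" "b \<in> carrier A" "s \<in> D" "t \<in> D"
  shows "frac A S a s \<oplus>\<^bsub>localization A S\<^esub> frac A S b t = frac A S (a \<otimes> t \<oplus> b \<otimes> s) (s \<otimes> t)"
proof -
  have "(\<lambda>(a, s) (b, t). frac A S (a \<otimes> t \<oplus> b \<otimes> s) (s \<otimes> t)) respects2 (frac_rel A S)"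
  proof (rule congruent2_commuteI[OF equiv_frac_rel], clarify)
    fix a s b t assume "a \<in> carrier A" "s \<in> D" "b \<in> carrier A" "t \<in> D"
    then show "frac A S (a \<otimes> t \<oplus> b \<otimes> s) (s \<otimes> t) = frac A S (b \<otimes> s \<oplus> a \<otimes> t) (t \<otimes> s)"
      by (metis m_comm a_comm m_closed denoms_closed)
  next
    fix y z w assume w: "w \<in> carrier A \<times> D" and yz: "(y, z) \<in> frac_rel A S"
    obtain c x a s b t where [simp]: "w = (c, x)" "y = (a, s)" "z = (b, t)"
      by (metis surj_pair)
    obtain u where ab [simp]: "a \<in> carrier A" "b \<in> carrier A" "s \<in> D" "t \<in> D" "u \<in> D"
      and u: "u \<otimes> (a \<otimes> t \<ominus> b \<otimes> s) = \<zero>" using yz by (auto elim: frac_relE)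
    have carr [simp]: "s \<in> carrier A" "t \<in> carrier A" "u \<in> carrier A" "c \<in> carrier A" "x \<in> D"
      "x \<in> carrier A" using w by auto
    have "u \<otimes> ((c \<otimes> s \<oplus> a \<otimes> x) \<otimes> (x \<otimes> t) \<ominus> (c \<otimes> t \<oplus> b \<otimes> x) \<otimes> (x \<otimes> s)) =
        x \<otimes> x \<otimes> (u \<otimes> (a \<otimes> t \<ominus> b \<otimes> s))"
      using ab carr by algebra
    with u show "(case w of (a, s) \<Rightarrow> \<lambda>(b, t). frac A S (a \<otimes> t \<oplus> b \<otimes> s) (s \<otimes> t)) y =
        (case w of (a, s) \<Rightarrow> \<lambda>(b, t). frac A S (a \<otimes> t \<oplus> b \<otimes> s) (s \<otimes> t)) z"
      by (simp, intro frac_eqI[where u = u]) auto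
  qed
  from UN_equiv_class2[OF equiv_frac_rel equiv_frac_rel this, of "(a, s)" "(b, t)"] assms
  show ?thesis by (simp add: localization_def frac_def[of A S a s] frac_def[of A S b t]
      case_prod_unfold)
qed

lemma one_localization: "\<one>\<^bsub>localization A S\<^esub> = frac A S \<one> \<one>"
  by (simp add: localization_def)

end

text \<open>Injectivity and surjectivity of \<open>h\<close> are asked only up to denominators,
  since these become units. That denominators map onto denominators serves twice: fractions go to
  fractions, and denominators of the target lift.\<close>

lemma localization_iso:
  assumes "localization_setting A S" and "localization_setting B T"
    and hom: "h \<in> ring_hom A B" and img: "h ` denoms A S = denoms B T"
    and inj: "\<And>a. a \<in> carrier A \<Longrightarrow> h a = \<zero>\<^bsub>B\<^esub> \<Longrightarrow> \<exists>s\<in>denoms A S. s \<otimes>\<^bsub>A\<^esub> a = \<zero>\<^bsub>A\<^esub>"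
    and surj: "\<And>b. b \<in> carrier B \<Longrightarrow> \<exists>a\<in>carrier A. \<exists>s\<in>denoms A S. h a = h s \<otimes>\<^bsub>B\<^esub> b"
  shows "\<exists>\<phi>\<in>ring_iso (localization A S) (localization B T).
           \<forall>a\<in>carrier A. \<phi> (loc_map A S a) = loc_map B T (h a)"
proof -
  interpret A: localization_setting A S by fact
  interpret B: localization_setting B T by fact
  interpret h: ring_hom_cring A B h
    by (intro ring_hom_cring.intro A.is_cring B.is_cring ring_hom_cring_axioms.intro hom)
  have hD [simp, intro]: "h s \<in> B.D" if "s \<in> A.D" for s
    using that img by blast
  define \<phi> where "\<phi> P = (\<Union>(a, s)\<in>P. frac B T (h a) (h s))" for P
  have \<phi>: "\<phi> (frac A S a s) = frac B T (h a) (h s)" if "a \<in> carrier A" "s \<in> A.D" for a s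
  proof -
    have "(\<lambda>(a, s). frac B T (h a) (h s)) respects (frac_rel A S)"
    proof (rule congruentI, clarify)
      fix a s b t assume "((a, s), (b, t)) \<in> frac_rel A S"
      then obtain u where ab [simp]: "a \<in> carrier A" "b \<in> carrier A" "s \<in> A.D" "t \<in> A.D" "u \<in> A.D"
        and u: "u \<otimes>\<^bsub>A\<^esub> (a \<otimes>\<^bsub>A\<^esub> t \<ominus>\<^bsub>A\<^esub> b \<otimes>\<^bsub>A\<^esub> s) = \<zero>\<^bsub>A\<^esub>" by (rule A.frac_relE)
      have carr [simp]: "s \<in> carrier A" "t \<in> carrier A" "u \<in> carrier A" by auto
      have "h u \<otimes>\<^bsub>B\<^esub> (h a \<otimes>\<^bsub>B\<^esub> h t \<ominus>\<^bsub>B\<^esub> h b \<otimes>\<^bsub>B\<^esub> h s) =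
          h (u \<otimes>\<^bsub>A\<^esub> (a \<otimes>\<^bsub>A\<^esub> t \<ominus>\<^bsub>A\<^esub> b \<otimes>\<^bsub>A\<^esub> s))"
        by (simp add: A.minus_eq B.minus_eq)
      with u show "frac B T (h a) (h s) = frac B T (h b) (h t)"
        by (intro B.frac_eqI[where u = "h u"]) auto
    qed
    from UN_equiv_class[OF A.equiv_frac_rel this, of "(a, s)"] that
    show ?thesis by (simp add: \<phi>_def frac_def[of A S a s])
  qed
  have "\<phi> \<in> ring_hom (localization A S) (localization B T)"
    by (rule ring_hom_memI)
      (auto simp: A.carrier_localization \<phi> A.frac_mult A.frac_add B.frac_mult B.frac_add
        A.one_localization B.one_localization)
  moreover have "inj_on \<phi> (carrier (localization A S))"
  proof (rule inj_onI, clarsimp simp: A.carrier_localization)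
    fix a s b t
    assume [simp]: "a \<in> carrier A" "s \<in> A.D" "b \<in> carrier A" "t \<in> A.D"
      and eq: "\<phi> (frac A S a s) = \<phi> (frac A S b t)"
    have carr [simp]: "s \<in> carrier A" "t \<in> carrier A" by auto
    from eq obtain v where "v \<in> B.D"
      and v: "v \<otimes>\<^bsub>B\<^esub> (h a \<otimes>\<^bsub>B\<^esub> h t \<ominus>\<^bsub>B\<^esub> h b \<otimes>\<^bsub>B\<^esub> h s) = \<zero>\<^bsub>B\<^esub>"
      by (auto simp: \<phi> B.frac_eq_iff)
    then obtain u where [simp]: "u \<in> A.D" and "v = h u" using img by blast
    then have [simp]: "u \<in> carrier A" by blast
    \<comment> \<open>With v = h u, equality in the target says that \<open>h\<close> kills u (a t -
      b s). By \<open>inj\<close> a further denominator \<open>x\<close> kills it in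
      \<open>A\<close>, so x u witnesses equality of the fractions.\<close>
    have "h (u \<otimes>\<^bsub>A\<^esub> (a \<otimes>\<^bsub>A\<^esub> t \<ominus>\<^bsub>A\<^esub> b \<otimes>\<^bsub>A\<^esub> s)) = \<zero>\<^bsub>B\<^esub>"
      using v by (simp add: \<open>v = h u\<close> A.minus_eq B.minus_eq)
    from inj[OF _ this] obtain x where [simp]: "x \<in> A.D"
      and x: "x \<otimes>\<^bsub>A\<^esub> (u \<otimes>\<^bsub>A\<^esub> (a \<otimes>\<^bsub>A\<^esub> t \<ominus>\<^bsub>A\<^esub> b \<otimes>\<^bsub>A\<^esub> s)) = \<zero>\<^bsub>A\<^esub>" by auto
    have "x \<in> carrier A" by auto
    with x show "frac A S a s = frac A S b t"
      by (intro A.frac_eqI[where u = "x \<otimes>\<^bsub>A\<^esub> u"]) (auto simp: A.m_assoc)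
  qed
  moreover have "\<exists>P\<in>carrier (localization A S). \<phi> P = frac B T b v"
    if b [simp]: "b \<in> carrier B" and v [simp]: "v \<in> B.D" for b v
  proof -
    \<comment> \<open>The preimage of b/v will be a/(s t), where h t = v and h a = h s b.\<close>
    obtain t where [simp]: "t \<in> A.D" and vt: "v = h t" using img v by blast
    obtain a s where ab [simp]: "a \<in> carrier A" "s \<in> A.D" and as: "h a = h s \<otimes>\<^bsub>B\<^esub> b"
      using surj[OF b] by blast
    have carr [simp]: "s \<in> carrier A" "t \<in> carrier A" by auto
    have [simp]: "h s \<in> carrier B" "h t \<in> carrier B" by auto
    have "h s \<otimes>\<^bsub>B\<^esub> b \<otimes>\<^bsub>B\<^esub> h t = b \<otimes>\<^bsub>B\<^esub> (h s \<otimes>\<^bsub>B\<^esub> h t)"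
      by (simp only: B.m_ac B.m_closed \<open>b \<in> carrier B\<close> \<open>h s \<in> carrier B\<close> \<open>h t \<in> carrier B\<close>)
    then have "frac B T (h a) (h s \<otimes>\<^bsub>B\<^esub> h t) = frac B T b v"
      by (intro B.frac_eqI[where u = "\<one>\<^bsub>B\<^esub>"]) (simp_all add: as vt B.minus_eq B.r_neg)
    moreover have "\<phi> (frac A S a (s \<otimes>\<^bsub>A\<^esub> t)) = frac B T (h a) (h s \<otimes>\<^bsub>B\<^esub> h t)"
      by (simp add: \<phi>)
    ultimately show ?thesis
      by (intro bexI[of _ "frac A S a (s \<otimes>\<^bsub>A\<^esub> t)"]) auto
  qed
  then have "carrier (localization B T) \<subseteq> \<phi> ` carrier (localization A S)"
    unfolding B.carrier_localization by (smt (verit) image_iff mem_Collect_eq subsetI)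
  moreover have "\<phi> ` carrier (localization A S) \<subseteq> carrier (localization B T)"
    by (auto simp: A.carrier_localization \<phi>)
  ultimately have "\<phi> \<in> ring_iso (localization A S) (localization B T)"
    by (auto simp: ring_iso_def bij_betw_def)
  moreover have "\<phi> (loc_map A S a) = loc_map B T (h a)" if "a \<in> carrier A" for a
    using that by (simp add: loc_map_def \<phi>)
  ultimately show ?thesis by blast
qed

section \<open>Semigroups generated by a set\<close>

lemma gen_semigroup_carrier:
  assumes "cring A" "G \<subseteq> carrier A"
  shows "gen_semigroup A G \<subseteq> carrier A"
proof
  interpret cring A by fact
  fix s assume "s \<in> gen_semigroup A G"
  then show "s \<in> carrier A" by induction (use assms in auto)
qed

lemma gen_semigroup_setting:
  assumes "cring A" "G \<subseteq> carrier A"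
  shows "localization_setting A (gen_semigroup A G)"
  using assms gen_semigroup_carrier[OF assms]
  by (intro localization_setting.intro localization_setting_axioms.intro) (auto intro: gen_semigroup.mult)

text \<open>Matching generators suffices, as both sides consist of products of generators; this is
  how \<open>S_quot\<close> is seen to map onto \<open>S_target\<close>.\<close>

lemma gen_semigroup_hom_image:
  assumes A: "cring A" "G \<subseteq> carrier A" and h: "h \<in> ring_hom A B"
  shows "h ` gen_semigroup A G = gen_semigroup B (h ` G)"
proof (intro equalityI subsetI)
  fix x assume "x \<in> h ` gen_semigroup A G"
  then obtain s where "s \<in> gen_semigroup A G" and x: "x = h s" by blast
  then have "h s \<in> gen_semigroup B (h ` G)"
    by (induction arbitrary: x)
      (use gen_semigroup_carrier[OF A] ring_hom_mult[OF h] in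
        \<open>auto intro: gen_semigroup.intros simp: subset_iff\<close>)
  with x show "x \<in> gen_semigroup B (h ` G)" by simp
next
  fix x assume "x \<in> gen_semigroup B (h ` G)"
  then show "x \<in> h ` gen_semigroup A G"
  proof induction
    case (mult s t)
    then obtain s' t' where "s' \<in> gen_semigroup A G" "t' \<in> gen_semigroup A G" "s = h s'" "t = h t'"
      by blast
    with gen_semigroup_carrier[OF A] ring_hom_mult[OF h, of s' t'] show ?case
      by (intro image_eqI[of _ _ "s' \<otimes>\<^bsub>A\<^esub> t'"]) (auto simp: subset_iff intro: gen_semigroup.mult)
  qed (auto intro: gen_semigroup.incl)
qed

section \<open>Evaluation of polynomials\<close>

lemma poly_mapping_induct_add [case_names zero single add]:
  assumes "P 0" "\<And>k v. P (Poly_Mapping.single k v)" "\<And>p q. P p \<Longrightarrow> P q \<Longrightarrow> P (p + q)"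
  shows "P (p :: 'a \<Rightarrow>\<^sub>0 'b::monoid_add)"
proof (induction p rule: update_induct)
  case const
  then show ?case by (rule assms(1))
next
  case (update p a b)
  \<comment> \<open>\<open>a\<close> is not a key of \<open>p\<close>, so setting its value amounts
    to adding a single term.\<close>
  have "Poly_Mapping.update a b p = Poly_Mapping.single a b + p"
    using update(1)
    by (intro poly_mapping_eqI) (auto simp: lookup_update lookup_add lookup_single in_keys_iff when_def)
  with update assms show ?case by simp
qed

lemma mvconst_add: "mvconst (a + b) = mvconst a + mvconst b"
  by (simp add: mvconst_def single_add)

lemma mvconst_mult: "mvconst (a * b) = mvconst a * mvconst b"
  by (simp add: mvconst_def mult_single)

lemma mvconst_0 [simp]: "mvconst 0 = 0"
  by (simp add: mvconst_def)

lemma mvconst_1 [simp]: "mvconst 1 = 1"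
  by (simp add: mvconst_def)

lemma mvvar_power: "mvvar v ^ n = Poly_Mapping.single (Poly_Mapping.single v n) 1"
  by (induction n) (simp_all add: mvvar_def mult_single single_add[symmetric])

text \<open>A single term is a constant times a product of powers of variables. Claims stable under
  sums and products are thereby reduced to constants and variables.\<close>

lemma mvpoly_induct [case_names const var add mult]:
  fixes p :: "('v, 'r::comm_ring_1) mvpoly"
  assumes const: "\<And>c. P (mvconst c)" and var: "\<And>v. P (mvvar v)"
    and add: "\<And>p q. P p \<Longrightarrow> P q \<Longrightarrow> P (p + q)" and mult: "\<And>p q. P p \<Longrightarrow> P q \<Longrightarrow> P (p * q)"
  shows "P p"
proof (induction p rule: poly_mapping_induct_add)
  case zero
  show ?case using const[of 0] by simp
next
  case (single m c)
  have "P (Poly_Mapping.single m 1)"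
  proof (induction m rule: poly_mapping_induct_add)
    case zero
    show ?case using const[of 1] by simp
  next
    case (single v n)
    have "P (mvvar v ^ n)"
      using const[of 1] by (induction n) (simp_all add: var mult)
    then show ?case by (simp add: mvvar_power)
  next
    case (add m n)
    from mult[OF add] show ?case by (simp add: mult_single)
  qed
  from mult[OF const[of c] this] show ?case
    by (simp add: mvconst_def mult_single)
next
  case (add p q)
  then show ?case by (rule assms(3))
qed

text \<open>The product ranges over the whole, possibly infinite variable type; exponents have
  finite support, so all but finitely many factors are 1.\<close>

definition mv_monom :: "('v \<Rightarrow> 's::comm_ring_1) \<Rightarrow> ('v \<Rightarrow>\<^sub>0 nat) \<Rightarrow> 's"
  where "mv_monom f m = (\<Prod>v. f v ^ Poly_Mapping.lookup m v)"

lemma mv_monom_0: "mv_monom f 0 = 1"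
  by (simp add: mv_monom_def)

lemma mv_monom_add:
  fixes f :: "'v \<Rightarrow> 's::comm_ring_1"
  shows "mv_monom f (m + n) = mv_monom f m * mv_monom f n"
proof -
  have "finite {v. f v ^ Poly_Mapping.lookup k v \<noteq> 1}" for k :: "'v \<Rightarrow>\<^sub>0 nat"
    by (rule finite_subset[OF _ finite_lookup_nat[of k]]) (auto intro: gr0I)
  then show ?thesis
    by (simp add: mv_monom_def lookup_add power_add Prod_any.distrib)
qed

lemma mv_monom_single: "mv_monom f (Poly_Mapping.single v 1) = f v"
proof -
  have "f u ^ Poly_Mapping.lookup (Poly_Mapping.single v 1) u = (if u = v then f u else 1)" for u
    by (simp add: lookup_single when_def)
  then show ?thesis by (simp add: mv_monom_def)
qed

text \<open>The coefficient map is a parameter, so that an evaluation can itself act on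
  coefficients; maps out of the target ring, built in two steps, arise in this way.\<close>

definition mveval ::
    "('r::comm_ring_1 \<Rightarrow> 's::comm_ring_1) \<Rightarrow> ('v \<Rightarrow> 's) \<Rightarrow> ('v, 'r) mvpoly \<Rightarrow> 's"
  where "mveval h f p = (\<Sum>m. h (Poly_Mapping.lookup p m) * mv_monom f m)"

locale comm_ring_hom =
  fixes h :: "'r::comm_ring_1 \<Rightarrow> 's::comm_ring_1"
  assumes h_one: "h 1 = 1"
    and h_add: "h (a + b) = h a + h b"
    and h_mult: "h (a * b) = h a * h b"
begin

lemma h_zero: "h 0 = 0"
  using h_add[of 0 0] by simp

lemma h_uminus: "h (- a) = - h a"
  using h_add[of a "- a"] by (simp add: h_zero eq_neg_iff_add_eq_0 add.commute)

lemma h_diff: "h (a - b) = h a - h b"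
  using h_add[of a "- b"] by (simp add: h_uminus)

lemma mveval_single: "mveval h f (Poly_Mapping.single m c) = h c * mv_monom f m"
proof -
  have "h (Poly_Mapping.lookup (Poly_Mapping.single m c) k) * mv_monom f k =
      (if k = m then h c * mv_monom f k else 0)" for k
    by (simp add: lookup_single when_def h_zero)
  then show ?thesis by (simp add: mveval_def)
qed

lemma mveval_add: "mveval h f (p + q) = mveval h f p + mveval h f q"
proof -
  have "finite {m. h (Poly_Mapping.lookup r m) * mv_monom f m \<noteq> 0}" for r :: "('a, 'r) mvpoly"
    by (rule finite_subset[OF _ finite_lookup[of r]]) (auto simp: h_zero)
  then show ?thesis
    by (simp add: mveval_def lookup_add h_add distrib_right Sum_any.distrib)
qed

lemma mveval_0: "mveval h f 0 = 0"
  by (simp add: mveval_def h_zero)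

lemma mveval_mult: "mveval h f (p * q) = mveval h f p * mveval h f q"
proof (induction p rule: poly_mapping_induct_add)
  case (single m c)
  show ?case
    by (induction q rule: poly_mapping_induct_add)
      (simp_all add: mveval_0 mult_single mveval_single h_mult mv_monom_add mveval_add algebra_simps)
qed (simp_all add: mveval_0 mveval_add distrib_right)

lemma mveval_mvconst: "mveval h f (mvconst c) = h c"
  by (simp add: mvconst_def mveval_single mv_monom_0)

lemma mveval_mvvar: "mveval h f (mvvar v) = f v"
  by (simp only: mvvar_def mveval_single mv_monom_single h_one mult_1)

lemma comm_ring_hom_mveval: "comm_ring_hom (mveval h f)"
  by unfold_locales (use mveval_mvconst[of f 1] in
      \<open>simp_all add: h_one mveval_add mveval_mult\<close>)

end

section \<open>Adjoining an inverse\<close>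

text \<open>This passes from ideals of the record \<open>ring_of_type_algebra\<close> to type class
  operations. Closure under negation comes from multiplying by -1.\<close>

lemma ideal_ring_of_type_algebra_iff:
  fixes I :: "'a::comm_ring_1 set"
  shows "ideal I ring_of_type_algebra \<longleftrightarrow>
    0 \<in> I \<and> (\<forall>a\<in>I. \<forall>b\<in>I. a + b \<in> I) \<and> (\<forall>a\<in>I. \<forall>c. c * a \<in> I)" (is "?l \<longleftrightarrow> ?r")
proof
  assume ?l
  then interpret ideal I ring_of_type_algebra .
  show ?r using additive_subgroup.zero_closed[OF is_additive_subgroup] additive_subgroup.a_closed[OF is_additive_subgroup] I_l_closed
    by (simp add: ring_of_type_algebra_def)
next
  interpret cring "ring_of_type_algebra :: 'a ring" ..
  have inv: "inv\<^bsub>add_monoid ring_of_type_algebra\<^esub> a = - a" for a :: 'a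
    by (rule add.inv_equality[unfolded a_inv_def]) (auto simp: ring_of_type_algebra_def)
  assume r: ?r
  have neg: "- a \<in> I" if "a \<in> I" for a
    using r that mult_minus1[of a] by metis
  have "subgroup I (add_monoid ring_of_type_algebra)"
  proof (rule group.subgroupI[OF add.is_group])
    show "I \<noteq> {}" using r by blast
    show "inv\<^bsub>add_monoid ring_of_type_algebra\<^esub> a \<in> I" if "a \<in> I" for a
      unfolding inv using that by (rule neg)
  qed (use r in \<open>simp_all add: ring_of_type_algebra_def\<close>)
  with r show ?l
    by (intro idealI ring_axioms) (simp_all add: ring_of_type_algebra_def mult.commute)
qed

locale type_ideal =
  fixes I :: "'a::comm_ring_1 set"
  assumes ideal: "ideal I ring_of_type_algebra"
begin

lemma zero_mem [simp, intro]: "0 \<in> I"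
  and add_mem: "a \<in> I \<Longrightarrow> b \<in> I \<Longrightarrow> a + b \<in> I"
  and mult_mem: "a \<in> I \<Longrightarrow> c * a \<in> I"
  using ideal by (auto simp: ideal_ring_of_type_algebra_iff)

lemma uminus_mem: "a \<in> I \<Longrightarrow> - a \<in> I"
  using mult_mem[of a "- 1"] by simp

lemma diff_mem: "a \<in> I \<Longrightarrow> b \<in> I \<Longrightarrow> a - b \<in> I"
  using add_mem[of a "- b"] uminus_mem by simp

lemma sum_mem: "(\<And>i. i \<in> J \<Longrightarrow> f i \<in> I) \<Longrightarrow> sum f J \<in> I"
  by (induction J rule: infinite_finite_induct) (auto intro: add_mem)

text \<open>This is the ideal I[t] + (w t - 1) of A[t], where A is the ambient ring and
  \<open>[:- 1, w:]\<close> is w t - 1; the quotient by it is (A/I)[1/w].\<close>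

definition adjoin_inverse_ideal :: "'a \<Rightarrow> 'a poly set"
  where "adjoin_inverse_ideal w = {a + [:- 1, w:] * b | a b. \<forall>i. coeff a i \<in> I}"

lemma type_ideal_adjoin_inverse: "type_ideal (adjoin_inverse_ideal w)"
proof (unfold type_ideal_def ideal_ring_of_type_algebra_iff, intro conjI ballI allI)
  show "0 \<in> adjoin_inverse_ideal w"
    by (auto simp: adjoin_inverse_ideal_def intro!: exI[of _ 0])
next
  fix p q assume "p \<in> adjoin_inverse_ideal w" "q \<in> adjoin_inverse_ideal w"
  then obtain a b a' b' where "p = a + [:- 1, w:] * b" "q = a' + [:- 1, w:] * b'"
    and "\<forall>i. coeff a i \<in> I" "\<forall>i. coeff a' i \<in> I"
    by (auto simp: adjoin_inverse_ideal_def)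
  then have "p + q = (a + a') + [:- 1, w:] * (b + b') \<and> (\<forall>i. coeff (a + a') i \<in> I)"
    by (simp only: coeff_add add_mem distrib_left) (simp add: algebra_simps)
  then show "p + q \<in> adjoin_inverse_ideal w" unfolding adjoin_inverse_ideal_def by blast
next
  fix p c assume "p \<in> adjoin_inverse_ideal w"
  then obtain a b where "p = a + [:- 1, w:] * b" and "\<forall>i. coeff a i \<in> I"
    by (auto simp: adjoin_inverse_ideal_def)
  then have "c * p = c * a + [:- 1, w:] * (c * b) \<and> (\<forall>i. coeff (c * a) i \<in> I)"
    by (auto simp only: coeff_mult distrib_left mult.left_commute intro!: sum_mem mult_mem)
  then show "c * p \<in> adjoin_inverse_ideal w" unfolding adjoin_inverse_ideal_def by blast
qed

text \<open>
  If \<open>p = a + (w t - 1) b\<close> with \<open>a\<close> in \<open>I[t]\<close>, comparing coefficients gives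
  \<open>b\<^sub>0 \<equiv> - p\<close> and \<open>b\<^sub>n\<^sub>+\<^sub>1 \<equiv> w b\<^sub>n\<close> modulo \<open>I\<close>, and \<open>b\<close> has finite degree.
\<close>

lemma adjoin_inverse_ideal_contracts:
  assumes "[:p:] \<in> adjoin_inverse_ideal w"
  shows "\<exists>N. w ^ N * p \<in> I"
proof -
  obtain a b where ab: "[:p:] = a + [:- 1, w:] * b" and a: "\<And>i. coeff a i \<in> I"
    using assms by (auto simp: adjoin_inverse_ideal_def)
  have coeffs: "coeff [:p:] n = coeff a n + coeff ([:- 1, w:] * b) n" for n
    by (subst ab) simp
  have "w ^ n * p + coeff b n \<in> I" for n
  proof (induction n)
    case 0
    have "w ^ 0 * p + coeff b 0 = coeff a 0" using coeffs[of 0] by simp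
    with a show ?case by simp
  next
    case (Suc n)
    have "w ^ Suc n * p + coeff b (Suc n) = w * (w ^ n * p + coeff b n) + coeff a (Suc n)"
      using coeffs[of "Suc n"] by (simp add: algebra_simps)
    with a Suc show ?case by (simp only: add_mem mult_mem)
  qed
  from this[of "Suc (degree b)"] show ?thesis
    by (intro exI[of _ "Suc (degree b)"]) (simp add: coeff_eq_0)
qed

end

section \<open>The ring in four variables per color\<close>

fun color_image :: "'l color_var \<Rightarrow> ('l, 'r::comm_ring_1) target_poly" where
  "color_image (Cx l) = tx l"
| "color_image (Cy l) = ty l"
| "color_image (CX l) = tx l + tX * ty l"
| "color_image (CY l) = ty l + tY * tx l"

definition color_eval :: "('l, 'r::comm_ring_1) color_poly \<Rightarrow> ('l, 'r) target_poly"
  where "color_eval = mveval tconst color_image"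

interpretation tconst: comm_ring_hom tconst
  by unfold_locales (simp_all add: tconst_def mvconst_add mvconst_mult)

interpretation color_eval: comm_ring_hom color_eval
  unfolding color_eval_def by (rule tconst.comm_ring_hom_mveval)

lemma color_eval_const [simp]: "color_eval (mvconst c) = tconst c"
  by (simp add: color_eval_def tconst.mveval_mvconst)

lemma color_eval_var [simp]: "color_eval (mvvar v) = color_image v"
  by (simp add: color_eval_def tconst.mveval_mvvar)

lemma I1_ideal: "ideal I1 color_ring"
  unfolding I1_def color_ring_def
  by (rule ring.genideal_ideal) (auto simp: ring_of_type_algebra_def
      intro: ring_from_type_algebra[unfolded ring_of_type_algebra_def])

interpretation I1: type_ideal "I1 :: ('l, 'r::comm_ring_1) color_poly set"
  using I1_ideal by (simp add: type_ideal_def color_ring_def)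

lemma I1_gens_subset: "I1_gens \<subseteq> I1"
  unfolding I1_def color_ring_def
  by (rule ring.genideal_self) (auto simp: ring_of_type_algebra_def
      intro: ring_from_type_algebra[unfolded ring_of_type_algebra_def])

text \<open>This is a generator rearranged. Read as fractions, it says that (X_l - x_l) / y_l does
  not depend on the color; the common value is the future X.\<close>

lemma I1_gen_X:
  "(mvvar (CX l) - mvvar (Cx l)) * mvvar (Cy m) - (mvvar (CX m) - mvvar (Cx m)) * mvvar (Cy l) \<in> I1"
proof -
  have "det2 (mvvar (CX l)) (mvvar (Cy l)) (mvvar (CX m)) (mvvar (Cy m))
      - det2 (mvvar (Cx l)) (mvvar (Cy l)) (mvvar (Cx m)) (mvvar (Cy m)) \<in> I1"
    by (rule subsetD[OF I1_gens_subset]) (unfold I1_gens_def, blast)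
  then show ?thesis by (simp add: det2_def algebra_simps)
qed

text \<open>Likewise (Y_l - y_l) / x_l does not depend on the color and is the future Y.\<close>

lemma I1_gen_Y:
  "(mvvar (CY l) - mvvar (Cy l)) * mvvar (Cx m) - (mvvar (CY m) - mvvar (Cy m)) * mvvar (Cx l) \<in> I1"
proof -
  have "det2 (mvvar (Cx l)) (mvvar (Cy l)) (mvvar (Cx m)) (mvvar (Cy m))
      - det2 (mvvar (Cx l)) (mvvar (CY l)) (mvvar (Cx m)) (mvvar (CY m)) \<in> I1"
    by (rule subsetD[OF I1_gens_subset]) (unfold I1_gens_def, blast)
  then show ?thesis by (simp add: det2_def algebra_simps)
qed

text \<open>The kernel of \<open>color_eval\<close> is an ideal, so only generators matter. As X_l -
  x_l goes to X y_l and Y_l - y_l to Y x_l, both terms of a rearranged generator become X y_l y_m,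
  or Y x_l x_m, and cancel.\<close>

lemma color_eval_I1: "p \<in> I1 \<Longrightarrow> color_eval p = 0"
proof -
  have "ideal {p. color_eval p = 0} color_ring"
    by (simp add: color_ring_def ideal_ring_of_type_algebra_iff color_eval.h_zero color_eval.h_add
        color_eval.h_mult)
  moreover have "I1_gens \<subseteq> {p. color_eval p = 0}"
    by (auto simp: I1_gens_def det2_def color_eval.h_diff color_eval.h_mult)
      (simp_all add: algebra_simps)
  ultimately have "I1 \<subseteq> {p. color_eval p = 0}"
    unfolding I1_def color_ring_def by (intro ring.genideal_minimal ring_from_type_algebra)
  then show "p \<in> I1 \<Longrightarrow> color_eval p = 0" by blast
qed

section \<open>The quotient by \<open>I1\<close> and the induced map\<close>

lemma color_quot_cring: "cring color_quot"
  unfolding color_quot_def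
  by (rule ideal.quotient_is_cring[OF I1_ideal]) (simp add: color_ring_def cring_from_type_algebra)

lemma color_class_hom: "color_class \<in> ring_hom color_ring color_quot"
  using ideal.rcos_ring_hom[OF I1_ideal]
  by (simp add: color_quot_def color_class_def[abs_def])

lemma color_class_mem [simp]: "color_class p \<in> carrier color_quot"
  using ring_hom_closed[OF color_class_hom, of p]
  by (simp add: color_ring_def ring_of_type_algebra_def)

lemma color_class_simps:
  fixes p q :: "('l, 'r::comm_ring_1) color_poly"
  shows "color_class p \<oplus>\<^bsub>color_quot\<^esub> color_class q = color_class (p + q)"
  "color_class p \<otimes>\<^bsub>color_quot\<^esub> color_class q = color_class (p * q)"
  "\<one>\<^bsub>color_quot\<^esub> = color_class (1 :: ('l, 'r) color_poly)"
  "\<zero>\<^bsub>color_quot\<^esub> = color_class (0 :: ('l, 'r) color_poly)"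
proof -
  interpret ring_hom_cring color_ring color_quot "color_class :: ('l, 'r) color_poly \<Rightarrow> _"
    by (intro ring_hom_cring.intro ring_hom_cring_axioms.intro color_quot_cring color_class_hom)
      (simp add: color_ring_def cring_from_type_algebra)
  show "color_class p \<oplus>\<^bsub>color_quot\<^esub> color_class q = color_class (p + q)"
    "color_class p \<otimes>\<^bsub>color_quot\<^esub> color_class q = color_class (p * q)"
    "\<one>\<^bsub>color_quot\<^esub> = color_class (1 :: ('l, 'r) color_poly)"
    "\<zero>\<^bsub>color_quot\<^esub> = color_class (0 :: ('l, 'r) color_poly)"
    using hom_add[of p q] hom_mult[of p q] hom_one hom_zero
    by (simp_all add: color_ring_def ring_of_type_algebra_def)
qed

lemma carrier_color_quot: "carrier color_quot = range color_class"
  by (auto simp: color_quot_def FactRing_def A_RCOSETS_def' color_class_def color_ring_def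
      ring_of_type_algebra_def)

lemma color_class_eq: "color_class p = {i + p | i. i \<in> I1}"
  by (auto simp: color_class_def a_r_coset_def' color_ring_def ring_of_type_algebra_def)

lemma color_class_eq_0:
  assumes p: "p \<in> I1"
  shows "color_class p = color_class 0"
proof -
  have "\<exists>i. x = i + p \<and> i \<in> I1" if "x \<in> I1" for x
    using I1.diff_mem[OF that p] by (intro exI[of _ "x - p"]) simp
  then show ?thesis by (auto simp: color_class_eq intro: I1.add_mem[OF _ p])
qed

text \<open>The map induced on the quotient: \<open>color_eval\<close> is constant on each coset of
  \<open>I1\<close>, so the image of a class is a singleton and \<open>the_elem\<close> extracts its
  value.\<close>

definition quot_eval :: "('l, 'r::comm_ring_1) color_poly set \<Rightarrow> ('l, 'r) target_poly"
  where "quot_eval P = the_elem (color_eval ` P)"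

lemma quot_eval_class [simp]: "quot_eval (color_class p) = color_eval p"
proof -
  have "color_eval ` color_class p = {color_eval p}"
    using I1.zero_mem by (force simp: color_class_eq color_eval.h_add color_eval_I1)
  then show ?thesis by (simp add: quot_eval_def)
qed

lemma quot_eval_hom: "quot_eval \<in> ring_hom color_quot target_ring"
  by (rule ring_hom_memI)
    (auto simp: carrier_color_quot color_class_simps color_eval.h_add color_eval.h_mult
      color_eval.h_one target_ring_def ring_of_type_algebra_def)

section \<open>Denominators and surjectivity up to denominators\<close>

lemma quot_setting: "localization_setting color_quot S_quot"
  unfolding S_quot_def by (rule gen_semigroup_setting) (auto intro: color_quot_cring)

lemma target_setting: "localization_setting target_ring S_target"
  unfolding S_target_def target_ring_def
  by (rule gen_semigroup_setting) (auto simp: ring_of_type_algebra_def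
      intro: cring_from_type_algebra[unfolded ring_of_type_algebra_def])

lemma quot_eval_S_quot: "quot_eval ` S_quot = S_target"
  unfolding S_quot_def S_target_def
  by (subst gen_semigroup_hom_image[OF color_quot_cring _ quot_eval_hom])
    (auto simp: image_Un image_image)

lemma quot_eval_denoms: "quot_eval ` denoms color_quot S_quot = denoms target_ring S_target"
  by (simp add: denoms_def quot_eval_S_quot ring_hom_one[OF quot_eval_hom])

text \<open>With representatives of denominators, the later arguments concern polynomials rather
  than cosets.\<close>

definition color_denoms :: "('l, 'r::comm_ring_1) color_poly set"
  where "color_denoms = {s. color_class s \<in> denoms color_quot S_quot}"

lemma color_denoms_1: "1 \<in> color_denoms"
  using localization_setting.one_in_denoms[OF quot_setting]
  by (simp add: color_denoms_def color_class_simps)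

lemma color_denoms_mult: "s \<in> color_denoms \<Longrightarrow> t \<in> color_denoms \<Longrightarrow> s * t \<in> color_denoms"
  using localization_setting.denoms_mult[OF quot_setting, of "color_class s" "color_class t"]
  by (simp add: color_denoms_def color_class_simps)

lemma color_denoms_var: "mvvar (Cx l) \<in> color_denoms" "mvvar (Cy l) \<in> color_denoms"
  by (auto simp: color_denoms_def denoms_def S_quot_def intro: gen_semigroup.incl)

lemma color_denoms_power: "s \<in> color_denoms \<Longrightarrow> s ^ n \<in> color_denoms"
  by (induction n) (auto intro: color_denoms_1 color_denoms_mult)

text \<open>The elements reached up to a denominator are closed under sums, by a common denominator,
  and under products. So constants and variables suffice, and X and Y are reached with denominators
  y_l and x_l.\<close>

lemma color_eval_surj_up_to_denoms:
  fixes b :: "('l, 'r::comm_ring_1) target_poly"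
  shows "\<exists>p. \<exists>s\<in>color_denoms. color_eval p = color_eval s * b"
proof -
  define Q where "Q b \<longleftrightarrow> (\<exists>p. \<exists>s\<in>color_denoms. color_eval p = color_eval s * b)"
    for b :: "('l, 'r) target_poly"
  have QI: "Q b" if "color_eval p = color_eval s * b" "s \<in> color_denoms" for p s b
    using that by (auto simp: Q_def)
  have Q_image: "Q (color_eval p)" for p
    by (rule QI[of p 1]) (simp_all add: color_eval.h_one color_denoms_1)
  have Q_add: "Q (b + c)" if "Q b" "Q c" for b c
  proof -
    obtain p s q t where "s \<in> color_denoms" "t \<in> color_denoms"
      "color_eval p = color_eval s * b" "color_eval q = color_eval t * c"
      using \<open>Q b\<close> \<open>Q c\<close> by (auto simp: Q_def)
    then show ?thesis
      by (intro QI[of "p * t + q * s" "s * t"] color_denoms_mult)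
        (simp_all add: color_eval.h_add color_eval.h_mult algebra_simps)
  qed
  have Q_mult: "Q (b * c)" if "Q b" "Q c" for b c
  proof -
    obtain p s q t where "s \<in> color_denoms" "t \<in> color_denoms"
      "color_eval p = color_eval s * b" "color_eval q = color_eval t * c"
      using \<open>Q b\<close> \<open>Q c\<close> by (auto simp: Q_def)
    then show ?thesis
      by (intro QI[of "p * q" "s * t"] color_denoms_mult)
        (simp_all add: color_eval.h_mult algebra_simps)
  qed
  have "Q b"
  proof (induction b rule: mvpoly_induct)
    case (const c)
    \<comment> \<open>A constant of the outer ring is itself a polynomial in the x_l and y_l, hence
      a second induction.\<close>
    show ?case
    proof (induction c rule: mvpoly_induct)
      case (const c)
      show ?case using Q_image[of "mvconst c"] by (simp add: tconst_def)
    next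
      case (var v)
      show ?case
      proof (cases v)
        case (Sx l)
        then show ?thesis using Q_image[of "mvvar (Cx l)"] by (simp add: tx_def)
      next
        case (Sy l)
        then show ?thesis using Q_image[of "mvvar (Cy l)"] by (simp add: ty_def)
      qed
    qed (simp_all add: mvconst_add mvconst_mult Q_add Q_mult)
  next
    case (var v)
    show ?case
    proof (cases v)
      case BX
      \<comment> \<open>Any color will do; \<open>undefined\<close> is one, since types are
        nonempty. The difference X_l - x_l maps to y_l X.\<close>
      show ?thesis
        by (rule QI[of "mvvar (CX undefined) - mvvar (Cx undefined)" "mvvar (Cy undefined)"])
          (simp_all add: BX tX_def color_eval.h_diff color_denoms_var)
    next
      case BY
      show ?thesis
        by (rule QI[of "mvvar (CY undefined) - mvvar (Cy undefined)" "mvvar (Cx undefined)"])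
          (simp_all add: BY tY_def color_eval.h_diff color_denoms_var)
    qed
  qed (simp_all add: Q_add Q_mult)
  then show ?thesis by (simp add: Q_def)
qed

section \<open>Inverting the substitution after adjoining 1/(x_m y_m)\<close>

fun pullback_small :: "'l small_var \<Rightarrow> ('l, 'r::comm_ring_1) color_poly poly" where
  "pullback_small (Sx l) = [:mvvar (Cx l):]"
| "pullback_small (Sy l) = [:mvvar (Cy l):]"

text \<open>\<open>[:0, e:]\<close> is e t, and t stands for 1/(x_m y_m). Thus X becomes (X_m - x_m)
  / y_m and Y becomes (Y_m - y_m) / x_m, the values that \<open>I1\<close> makes independent of the
  color.\<close>

fun pullback_big :: "'l \<Rightarrow> big_var \<Rightarrow> ('l, 'r::comm_ring_1) color_poly poly" where
  "pullback_big m BX = [:0, (mvvar (CX m) - mvvar (Cx m)) * mvvar (Cx m):]"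
| "pullback_big m BY = [:0, (mvvar (CY m) - mvvar (Cy m)) * mvvar (Cy m):]"

definition pullback_const :: "'r::comm_ring_1 \<Rightarrow> ('l, 'r) color_poly poly"
  where "pullback_const c = [:mvconst c:]"

interpretation pullback_const: comm_ring_hom pullback_const
  by unfold_locales (simp_all add: pullback_const_def mvconst_add mvconst_mult one_pCons)

interpretation pullback_coeff: comm_ring_hom "mveval pullback_const pullback_small"
  by (rule pullback_const.comm_ring_hom_mveval)

definition pullback :: "'l \<Rightarrow> ('l, 'r::comm_ring_1) target_poly \<Rightarrow> ('l, 'r) color_poly poly"
  where "pullback m = mveval (mveval pullback_const pullback_small) (pullback_big m)"

interpretation pullback: comm_ring_hom "pullback m"
  unfolding pullback_def by (rule pullback_coeff.comm_ring_hom_mveval)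

lemma pullback_simps:
  "pullback m (tconst c) = [:mvconst c:]"
  "pullback m (tx l) = [:mvvar (Cx l):]"
  "pullback m (ty l) = [:mvvar (Cy l):]"
  "pullback m tX = [:0, (mvvar (CX m) - mvvar (Cx m)) * mvvar (Cx m):]"
  "pullback m tY = [:0, (mvvar (CY m) - mvvar (Cy m)) * mvvar (Cy m):]"
  by (simp_all add: pullback_def tconst_def tx_def ty_def tX_def tY_def pullback_coeff.mveval_mvconst
      pullback_coeff.mveval_mvvar pullback_const.mveval_mvconst pullback_const.mveval_mvvar pullback_const_def)

text \<open>Agreement modulo an ideal passes to sums and products, so constants and variables
  suffice. Constants, x_l and y_l return exactly; X_l and Y_l need the relations of
  \<open>I1\<close>.\<close>

lemma pullback_color_eval:
  "pullback m (color_eval p) - [:p:] \<in> I1.adjoin_inverse_ideal (mvvar (Cx m) * mvvar (Cy m))"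
    (is "_ \<in> ?J")
proof -
  interpret J: type_ideal ?J by (rule I1.type_ideal_adjoin_inverse)
  have JI: "pCons 0 [:e:] + [:- 1, mvvar (Cx m) * mvvar (Cy m):] * b \<in> ?J" if "e \<in> I1" for e b
  proof -
    have "\<forall>i. coeff (pCons 0 [:e:]) i \<in> I1"
      using that by (simp add: coeff_pCons split: nat.splits)
    then show ?thesis unfolding I1.adjoin_inverse_ideal_def by blast
  qed
  show ?thesis
  proof (induction p rule: mvpoly_induct)
    case (const c)
    show ?case by (simp add: pullback_simps)
  next
    case (var v)
    show ?case
    proof (cases v)
      case (CX l)
      let ?e = "(mvvar (CX l) - mvvar (Cx l)) * mvvar (Cy m)
          - (mvvar (CX m) - mvvar (Cx m)) * mvvar (Cy l) :: ('a, 'b) color_poly"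
      \<comment> \<open>Replacing (X_m - x_m) y_l by (X_l - x_l) y_m costs x_m t \<open>?e\<close>,
        with \<open>?e\<close> in \<open>I1\<close>. After that, x_m y_m t (X_l - x_l) differs from
        X_l - x_l by a multiple of w t - 1.\<close>
      have "pullback m (color_eval (mvvar v)) - [:mvvar v:] =
          pCons 0 [:- mvvar (Cx m) * ?e:] +
          [:- 1, mvvar (Cx m) * mvvar (Cy m):] * [:mvvar (CX l) - mvvar (Cx l):]"
        by (simp add: CX pullback_simps pullback.h_add pullback.h_mult algebra_simps)
      also have "\<dots> \<in> ?J" by (intro JI I1.mult_mem I1_gen_X)
      finally show ?thesis .
    next
      case (CY l)
      let ?e = "(mvvar (CY l) - mvvar (Cy l)) * mvvar (Cx m)
          - (mvvar (CY m) - mvvar (Cy m)) * mvvar (Cx l) :: ('a, 'b) color_poly"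
      have "pullback m (color_eval (mvvar v)) - [:mvvar v:] =
          pCons 0 [:- mvvar (Cy m) * ?e:] +
          [:- 1, mvvar (Cx m) * mvvar (Cy m):] * [:mvvar (CY l) - mvvar (Cy l):]"
        by (simp add: CY pullback_simps pullback.h_add pullback.h_mult algebra_simps)
      also have "\<dots> \<in> ?J" by (intro JI I1.mult_mem I1_gen_Y)
      finally show ?thesis .
    qed (simp_all add: pullback_simps)
  next
    case (add p q)
    have "pullback m (color_eval (p + q)) - [:p + q:] =
        (pullback m (color_eval p) - [:p:]) + (pullback m (color_eval q) - [:q:])"
      by (simp add: color_eval.h_add pullback.h_add)
    with J.add_mem[OF add] show ?case by simp
  next
    case (mult p q)
    \<comment> \<open>Writing F for the composite map, F(p) F(q) - p q splits so that each summand
      is a multiple of one induction hypothesis.\<close>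
    have eq: "pullback m (color_eval (p * q)) - [:p * q:] =
        pullback m (color_eval q) * (pullback m (color_eval p) - [:p:]) +
        [:p:] * (pullback m (color_eval q) - [:q:])"
    proof -
      have "[:p * q:] = [:p:] * [:q:]" by simp
      then show ?thesis
        by (simp only: color_eval.h_mult pullback.h_mult) (simp only: algebra_simps)
    qed
    show ?case
      unfolding eq by (rule J.add_mem[OF J.mult_mem[OF mult(1)] J.mult_mem[OF mult(2)]])
  qed
qed

text \<open>When the image is 0, the difference in \<open>pullback_color_eval\<close> is
  \<open>- [:p:]\<close>, and contraction applies. The multiplier found is a power of x_m y_m for
  the arbitrary color \<open>undefined\<close>, hence a denominator.\<close>

lemma color_eval_kernel:
  assumes "color_eval p = 0"
  shows "\<exists>s\<in>color_denoms. s * p \<in> I1"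
proof -
  have "[:p:] \<in> I1.adjoin_inverse_ideal (mvvar (Cx undefined) * mvvar (Cy undefined))" (is "_ \<in> ?J")
  proof -
    interpret J: type_ideal ?J by (rule I1.type_ideal_adjoin_inverse)
    show ?thesis
      using J.uminus_mem[OF pullback_color_eval[of undefined p]] assms by (simp add: pullback.h_zero)
  qed
  then obtain N where "(mvvar (Cx undefined) * mvvar (Cy undefined)) ^ N * p \<in> I1"
    using I1.adjoin_inverse_ideal_contracts by blast
  then show ?thesis
    by (rule bexI) (intro color_denoms_power color_denoms_mult color_denoms_var)
qed

theorem theorem3p19:
  "\<exists>\<phi> \<in> ring_iso
       (color_loc :: (('l, 'r::idom) color_poly set \<times> ('l, 'r) color_poly set) set ring)
       (target_loc :: (('l, 'r) target_poly \<times> ('l, 'r) target_poly) set ring).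
     (\<forall>c. \<phi> (to_color_loc (mvconst c)) = to_target_loc (tconst c)) \<and>
     (\<forall>l. \<phi> (to_color_loc (mvvar (Cx l))) = to_target_loc (tx l)) \<and>
     (\<forall>l. \<phi> (to_color_loc (mvvar (Cy l))) = to_target_loc (ty l)) \<and>
     (\<forall>l. \<phi> (to_color_loc (mvvar (CX l))) = to_target_loc (tx l + tX * ty l)) \<and>
     (\<forall>l. \<phi> (to_color_loc (mvvar (CY l))) = to_target_loc (ty l + tY * tx l))"
proof -
  \<comment> \<open>The isomorphism is first described on all classes at once, as the extension of
    \<open>quot_eval\<close>; its values on constants and variables are then read off from
    \<open>color_eval\<close>.\<close>
  have "\<exists>\<phi> \<in> ring_iso
       (color_loc :: (('l, 'r) color_poly set \<times> ('l, 'r) color_poly set) set ring)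
       (target_loc :: (('l, 'r) target_poly \<times> ('l, 'r) target_poly) set ring).
     \<forall>P\<in>carrier color_quot. \<phi> (loc_map color_quot S_quot P) = loc_map target_ring S_target (quot_eval P)"
    unfolding color_loc_def target_loc_def
  proof (rule localization_iso[OF quot_setting target_setting quot_eval_hom quot_eval_denoms])
    fix P :: "('l, 'r) color_poly set"
    assume "P \<in> carrier color_quot" "quot_eval P = \<zero>\<^bsub>target_ring\<^esub>"
    then obtain p where p: "P = color_class p" "color_eval p = 0"
      by (auto simp: carrier_color_quot target_ring_def ring_of_type_algebra_def)
    from color_eval_kernel[OF p(2)] obtain s where s: "s \<in> color_denoms" "s * p \<in> I1" by blast
    then have "color_class s \<in> denoms color_quot S_quot"
      and "color_class s \<otimes>\<^bsub>color_quot\<^esub> P = \<zero>\<^bsub>color_quot\<^esub>"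
      using color_class_eq_0[OF s(2)] by (simp_all add: p color_class_simps color_denoms_def)
    then show "\<exists>s\<in>denoms color_quot S_quot. s \<otimes>\<^bsub>color_quot\<^esub> P = \<zero>\<^bsub>color_quot\<^esub>" ..
  next
    fix b :: "('l, 'r) target_poly"
    obtain p s where "s \<in> color_denoms" "color_eval p = color_eval s * b"
      using color_eval_surj_up_to_denoms by blast
    then show "\<exists>P\<in>carrier color_quot. \<exists>s\<in>denoms color_quot S_quot.
        quot_eval P = quot_eval s \<otimes>\<^bsub>target_ring\<^esub> b"
      by (intro bexI[of _ "color_class p"] bexI[of _ "color_class s"])
        (auto simp: color_denoms_def target_ring_def ring_of_type_algebra_def)
  qed
  then obtain \<phi> where iso: "\<phi> \<in> ring_iso
       (color_loc :: (('l, 'r) color_poly set \<times> ('l, 'r) color_poly set) set ring)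
       (target_loc :: (('l, 'r) target_poly \<times> ('l, 'r) target_poly) set ring)"
    and \<phi>: "\<And>P. P \<in> carrier color_quot \<Longrightarrow>
      \<phi> (loc_map color_quot S_quot P) = loc_map target_ring S_target (quot_eval P)"
    by blast
  have "\<phi> (to_color_loc p) = to_target_loc (color_eval p)" for p
    by (simp add: to_color_loc_def to_target_loc_def \<phi>)
  with iso show ?thesis by (intro bexI[of _ \<phi>]) simp_all
qed

end
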